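(* Let $n \ge m$ and let $X \in \mathbb{R}^{n\times m}$ be an orthogonal design, i.e. $X^\top X = I_m$. Suppose $y = X\beta + \epsilon$ with unknown $\beta \in \mathbb{R}^m$ and noise $\epsilon \sim N(0,\sigma^2 I_n)$ with known $\sigma>0$. Fix an integer $k$ with $1 \le k \le m$ and a level $\alpha \in (0,1)$. Define the sequence $$\lambda_{k\text{-FWER}}(i)=\begin{cases}\Phi^{-1}\!\left(1-\dfrac{k\alpha}{2m}\right), & i\le k,\\[2mm] \Phi^{-1}\!\left(1-\dfrac{k\alpha}{2(m+k-i)}\right), & k< i\le m,\end{cases}$$ and let $\hat\beta$ be the $k$-SLOPE estimator $$\hat\beta \in \arg\min_{b\in\mathbb{R}^m}\ \frac12\|y-Xb\|_2^2+\sigma\sum_{i=1}^m \lambda_{k\text{-FWER}}(i)\,|b|_{(i)}.$$ Let $V$ be the number of indices $i$ with $\beta_i = 0$ but $\hat\beta_i \neq 0$ (false selections). Then $$k\text{-FWER} := \mathrm{Prob}\{V \ge k\} \le \alpha.$$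
   Context: $\Phi$ denotes the cumulative distribution function of the standard normal distribution and $\Phi^{-1}$ its inverse. For $b\in\mathbb{R}^m$, $|b|_{(1)}\ge |b|_{(2)}\ge\cdots\ge |b|_{(m)}$ denote the absolute values of the entries of $b$ sorted in non-increasing order. Feature $i$ is "selected" (the null hypothesis $H_i:\beta_i=0$ is rejected) when $\hat\beta_i\neq 0$. *)

theory Defs
  imports "HOL-Probability.Probability"
begin

definition Phi :: "real \<Rightarrow> real" where
  "Phi x = measure (density lborel std_normal_density) {..x}"

definition Phi_inv :: "real \<Rightarrow> real" where
  "Phi_inv p = (THE x. Phi x = p)"

text \<open>The k-FWER lambda sequence, indices i = 1..m.\<close>
definition lambda_kfwer :: "nat \<Rightarrow> nat \<Rightarrow> real \<Rightarrow> nat \<Rightarrow> real" where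
  "lambda_kfwer m k \<alpha> i =
     (if i \<le> k then Phi_inv (1 - real k * \<alpha> / (2 * real m))
      else Phi_inv (1 - real k * \<alpha> / (2 * real (m + k - i))))"

definition sorted_abs :: "nat \<Rightarrow> (nat \<Rightarrow> real) \<Rightarrow> nat \<Rightarrow> real" where
  "sorted_abs m b i = rev (sort (map (\<lambda>j. \<bar>b j\<bar>) [0..<m])) ! (i - 1)"

text \<open>The (k-)SLOPE objective; vectors in R^n / R^m are nat-indexed functions, only
  indices below n / m matter.  X is the n x m design matrix, X i j.\<close>
definition slope_obj ::
  "nat \<Rightarrow> nat \<Rightarrow> (nat \<Rightarrow> nat \<Rightarrow> real) \<Rightarrow> real \<Rightarrow> (nat \<Rightarrow> real) \<Rightarrow> (nat \<Rightarrow> real)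
    \<Rightarrow> (nat \<Rightarrow> real) \<Rightarrow> real" where
  "slope_obj n m X \<sigma> lam y b =
     1/2 * (\<Sum>i<n. (y i - (\<Sum>j<m. X i j * b j))\<^sup>2) + \<sigma> * (\<Sum>i=1..m. lam i * sorted_abs m b i)"

definition noise_dist :: "nat \<Rightarrow> real \<Rightarrow> (nat \<Rightarrow> real) measure" where
  "noise_dist n \<sigma> = PiM {..<n} (\<lambda>_. density lborel (normal_density 0 \<sigma>))"

end

theory Submission
  imports Defs
begin

text \<open>
  The statistics \<open>z = X\<^sup>T y\<close> are orthogonal images of the noise, so those of the null features are
  independent \<open>N(0, \<sigma>\<^sup>2)\<close>. If \<open>r\<close> features are selected, comparing the minimizer with the vector in
  which one selected coordinate is set to zero gives \<open>\<bar>z i\<bar> \<ge> \<sigma> \<lambda>(r)\<close> for each selected \<open>i\<close>, that is, the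
  two-sided p-value of \<open>i\<close> is at most \<open>k \<alpha> / (m + k - r)\<close>. With \<open>V \<ge> k\<close> false selections among
  \<open>m\<^sub>0\<close> nulls, \<open>r \<le> V + m - m\<^sub>0\<close> and \<open>(V - k) (m\<^sub>0 - V) \<ge> 0\<close> bound this level by \<open>V \<alpha> / m\<^sub>0\<close>. So \<open>V \<ge> k\<close>
  forces a rejection in Simes' test of the null p-values, which has probability at most \<open>\<alpha>\<close>.
\<close>

subsection \<open>Independence from characteristic functions\<close>

text \<open>Reweighting by \<open>g + 2\<close>, normalized, does not change the characteristic
  function of \<open>U\<close>, because \<open>char\<close> lets the weight factor out. By Levy's
  uniqueness theorem the law of \<open>U\<close> is unchanged as well, and the claim is this
  equality of laws evaluated at \<open>A\<close>.\<close>

lemma (in prob_space) weighted_char_imp_factorization: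
  fixes g U :: "'a \<Rightarrow> real"
  assumes U[measurable]: "random_variable borel U" and g[measurable]: "random_variable borel g"
    and bd: "\<And>\<omega>. \<bar>g \<omega>\<bar> \<le> 1"
    and char: "\<And>t. (CLINT \<omega>|M. iexp (t * U \<omega>) * g \<omega>) = (CLINT \<omega>|M. iexp (t * U \<omega>)) * expectation g"
    and A[measurable]: "A \<in> sets borel"
  shows "expectation (\<lambda>\<omega>. indicator A (U \<omega>) * g \<omega>) = prob {\<omega>\<in>space M. U \<omega> \<in> A} * expectation g"
proof -
  \<comment> \<open>The shift makes the weight positive, so that it is the density of a probability measure.\<close>
  define h where "h \<omega> = g \<omega> + 2" for \<omega>
  have h[measurable]: "random_variable borel h" unfolding h_def by measurable
  have hb: "1 \<le> h \<omega>" "h \<omega> \<le> 3" for \<omega> using bd[of \<omega>] by (auto simp: h_def)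
  have ig: "integrable M g" using bd by (intro integrable_const_bound[of _ 1]) auto
  then have ih: "integrable M h" by (simp add: h_def[abs_def])
  have Eh: "expectation h = expectation g + 2" using ig by (simp add: h_def[abs_def] prob_space)
  define e where "e = expectation h"
  have e: "1 \<le> e" unfolding e_def using hb ih
    by (metis integral_ge_const always_eventually)
  define D where "D = density M (\<lambda>\<omega>. ennreal (h \<omega> / e))"
  have h0: "0 \<le> h \<omega> / e" for \<omega> using hb[of \<omega>] e by simp
  have nn: "(\<integral>\<^sup>+\<omega>. ennreal (h \<omega> / e) \<partial>M) = 1"
    using ih e h0 by (subst nn_integral_eq_integral) (auto simp: e_def)
  interpret D: prob_space D
    by standard (simp add: D_def emeasure_density nn cong: nn_integral_cong)
  have UD[measurable]: "U \<in> borel_measurable D" by (simp add: D_def)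
  have "char (distr D borel U) t = char (distr M borel U) t" for t
  proof -
    have "char (distr D borel U) t = (CLINT \<omega>|D. iexp (t * U \<omega>))"
      by (simp add: char_def integral_distr)
    also have "\<dots> = (CLINT \<omega>|M. (h \<omega> / e) *\<^sub>R iexp (t * U \<omega>))"
      unfolding D_def using h0 by (intro integral_density) auto
    also have "\<dots> = (CLINT \<omega>|M. (iexp (t * U \<omega>) * g \<omega> + 2 * iexp (t * U \<omega>)) / e)"
      by (intro Bochner_Integration.integral_cong) (auto simp: scaleR_conv_of_real h_def algebra_simps add_divide_distrib)
    also have "\<dots> = ((CLINT \<omega>|M. iexp (t * U \<omega>) * g \<omega>) + (CLINT \<omega>|M. 2 * iexp (t * U \<omega>))) / e"
    proof -
      have "integrable M (\<lambda>\<omega>. iexp (t * U \<omega>) * g \<omega>)"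
        using bd by (intro integrable_const_bound[of _ 1]) (auto simp: norm_mult)
      moreover have "integrable M (\<lambda>\<omega>. 2 * iexp (t * U \<omega>))"
        by (intro integrable_const_bound[of _ 2]) (auto simp: norm_mult)
      ultimately show ?thesis by simp
    qed
    \<comment> \<open>Here \<open>char\<close> splits off the mean of \<open>g\<close>; the
      remaining factor is \<open>e / e\<close>.\<close>
    also have "\<dots> = (CLINT \<omega>|M. iexp (t * U \<omega>)) * (complex_of_real (expectation g + 2) / e)"
      unfolding char by (simp add: algebra_simps add_divide_distrib)
    also have "\<dots> = (CLINT \<omega>|M. iexp (t * U \<omega>))" using e Eh by (simp add: e_def del: of_real_add)
    finally show ?thesis by (simp add: char_def integral_distr)
  qed
  then have eq: "distr D borel U = distr M borel U"
    by (intro Levy_uniqueness real_distribution_distr D.real_distribution_distr) (auto simp: fun_eq_iff)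
  have iA: "integrable M (\<lambda>\<omega>. indicator A (U \<omega>) * g \<omega>)"
    using bd by (intro integrable_const_bound[of _ 1]) (auto simp: indicator_def)
  have "prob {\<omega>\<in>space M. U \<omega> \<in> A} = measure (distr M borel U) A"
    by (subst measure_distr) (auto simp: vimage_def Int_def conj_ac)
  also have "\<dots> = measure D (U -` A \<inter> space D)" by (simp add: eq[symmetric] measure_distr)
  also have "\<dots> = (LINT \<omega>|D. indicator (U -` A \<inter> space D) \<omega>)" by simp
  also have "\<dots> = (LINT \<omega>|D. indicator A (U \<omega>))"
    by (intro Bochner_Integration.integral_cong) (auto simp: indicator_def)
  also have "\<dots> = (LINT \<omega>|M. (h \<omega> / e) *\<^sub>R indicator A (U \<omega>))"
    unfolding D_def using h0 by (intro integral_density) auto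
  also have "\<dots> = (LINT \<omega>|M. (indicator A (U \<omega>) * g \<omega> + 2 * indicator A (U \<omega>)) / e)"
    by (intro Bochner_Integration.integral_cong) (auto simp: h_def algebra_simps)
  also have "\<dots> = (expectation (\<lambda>\<omega>. indicator A (U \<omega>) * g \<omega>) + 2 * expectation (\<lambda>\<omega>. indicator A (U \<omega>))) / e"
  proof -
    have "integrable M (\<lambda>\<omega>. 2 * indicator A (U \<omega>) :: real)"
      by (intro integrable_const_bound[of _ 2]) (auto simp: indicator_def)
    then show ?thesis using iA by simp
  qed
  also have "expectation (\<lambda>\<omega>. indicator A (U \<omega>)) = prob {\<omega>\<in>space M. U \<omega> \<in> A}"
  proof -
    have "expectation (\<lambda>\<omega>. indicator A (U \<omega>)) = expectation (indicator {\<omega>\<in>space M. U \<omega> \<in> A})"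
      by (intro Bochner_Integration.integral_cong) (auto simp: indicator_def)
    also have "\<dots> = prob {\<omega>\<in>space M. U \<omega> \<in> A}"
      by (subst Bochner_Integration.integral_indicator) (auto intro!: arg_cong[where f=prob])
    finally show ?thesis .
  qed
  \<comment> \<open>The shift contributes \<open>2 * prob\<close> to the numerator and 2 to
    \<open>e\<close>, and both contributions cancel after multiplying by \<open>e\<close>.\<close>
  finally show ?thesis using e Eh by (simp add: e_def field_simps)
qed

text \<open>The real and imaginary parts of \<open>g\<close> are linear combinations of
  \<open>g\<close> and its conjugate. Factorization for both of these therefore gives it for the two
  real weights, to which the real case applies.\<close>

lemma (in prob_space) weighted_char_imp_factorization_complex:
  fixes U :: "'a \<Rightarrow> real" and g :: "'a \<Rightarrow> complex"
  assumes U[measurable]: "random_variable borel U" and g[measurable]: "random_variable borel g"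
    and bd: "\<And>\<omega>. norm (g \<omega>) \<le> 1"
    and char: "\<And>t. (CLINT \<omega>|M. iexp (t * U \<omega>) * g \<omega>) = (CLINT \<omega>|M. iexp (t * U \<omega>)) * (CLINT \<omega>|M. g \<omega>)"
    and char_cnj: "\<And>t. (CLINT \<omega>|M. iexp (t * U \<omega>) * cnj (g \<omega>)) = (CLINT \<omega>|M. iexp (t * U \<omega>)) * (CLINT \<omega>|M. cnj (g \<omega>))"
    and A[measurable]: "A \<in> sets borel"
  shows "(CLINT \<omega>|M. indicator A (U \<omega>) * g \<omega>) = prob {\<omega>\<in>space M. U \<omega> \<in> A} * (CLINT \<omega>|M. g \<omega>)"
proof -
  have [measurable]: "cnj \<in> borel_measurable borel"
    by (intro borel_measurable_continuous_onI continuous_intros)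
  have bounded: "integrable M f" if "random_variable borel f" "\<And>\<omega>. norm (f \<omega>) \<le> 1" for f :: "'a \<Rightarrow> complex"
    using that by (intro integrable_const_bound[of _ 1]) auto
  have ig: "integrable M g" "integrable M (\<lambda>\<omega>. cnj (g \<omega>))"
    using bd by (auto intro!: bounded)
  have ic: "integrable M (\<lambda>\<omega>. iexp (t * U \<omega>) * g \<omega>)" "integrable M (\<lambda>\<omega>. iexp (t * U \<omega>) * cnj (g \<omega>))" for t
    using bd by (auto intro!: bounded simp: norm_mult)
  have ind: "indicator A x * y = complex_of_real (indicator A x) * y" for x :: real and y :: complex
    by (simp add: indicator_def)
  have re: "expectation (\<lambda>\<omega>. indicator A (U \<omega>) * Re (g \<omega>)) = prob {\<omega>\<in>space M. U \<omega> \<in> A} * expectation (\<lambda>\<omega>. Re (g \<omega>))"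
  proof (rule weighted_char_imp_factorization)
    have R: "complex_of_real (Re z) = (z + cnj z) / 2" for z by (simp add: complex_add_cnj)
    fix t
    have E: "complex_of_real (expectation (\<lambda>\<omega>. Re (g \<omega>))) = ((CLINT \<omega>|M. g \<omega>) + (CLINT \<omega>|M. cnj (g \<omega>))) / 2"
      unfolding integral_complex_of_real[symmetric] R using ig by simp
    show "(CLINT \<omega>|M. iexp (t * U \<omega>) * Re (g \<omega>)) = (CLINT \<omega>|M. iexp (t * U \<omega>)) * expectation (\<lambda>\<omega>. Re (g \<omega>))"
      unfolding E unfolding R using ic[of t] char[of t] char_cnj[of t] by (simp add: distrib_left)
  qed (use order_trans[OF abs_Re_le_cmod bd] in auto)
  have im: "expectation (\<lambda>\<omega>. indicator A (U \<omega>) * Im (g \<omega>)) = prob {\<omega>\<in>space M. U \<omega> \<in> A} * expectation (\<lambda>\<omega>. Im (g \<omega>))"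
  proof (rule weighted_char_imp_factorization)
    have R: "complex_of_real (Im z) = (z - cnj z) / (2 * \<i>)" for z
      unfolding complex_diff_cnj by (simp add: mult.commute)
    fix t
    have E: "complex_of_real (expectation (\<lambda>\<omega>. Im (g \<omega>))) = ((CLINT \<omega>|M. g \<omega>) - (CLINT \<omega>|M. cnj (g \<omega>))) / (2 * \<i>)"
      unfolding integral_complex_of_real[symmetric] R using ig by simp
    show "(CLINT \<omega>|M. iexp (t * U \<omega>) * Im (g \<omega>)) = (CLINT \<omega>|M. iexp (t * U \<omega>)) * expectation (\<lambda>\<omega>. Im (g \<omega>))"
    proof -
      have "(CLINT \<omega>|M. iexp (t * U \<omega>) * Im (g \<omega>))
          = (CLINT \<omega>|M. (iexp (t * U \<omega>) * g \<omega> - iexp (t * U \<omega>) * cnj (g \<omega>)) / (2 * \<i>))"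
        unfolding R by (simp only: right_diff_distrib times_divide_eq_right)
      also have "\<dots> = ((CLINT \<omega>|M. iexp (t * U \<omega>) * g \<omega>) - (CLINT \<omega>|M. iexp (t * U \<omega>) * cnj (g \<omega>))) / (2 * \<i>)"
        using ic[of t] by (subst integral_divide_zero) simp
      also have "\<dots> = (CLINT \<omega>|M. iexp (t * U \<omega>)) * expectation (\<lambda>\<omega>. Im (g \<omega>))"
        unfolding char char_cnj E by (simp only: right_diff_distrib times_divide_eq_right)
      finally show ?thesis .
    qed
  qed (use order_trans[OF abs_Im_le_cmod bd] in auto)
  have iA: "integrable M (\<lambda>\<omega>. indicator A (U \<omega>) * g \<omega>)"
    using bd by (intro bounded) (auto simp: norm_mult indicator_def)
  show ?thesis
  proof (rule complex_eqI)
    show "Re (CLINT \<omega>|M. indicator A (U \<omega>) * g \<omega>) = Re (prob {\<omega>\<in>space M. U \<omega> \<in> A} * (CLINT \<omega>|M. g \<omega>))"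
    proof -
      have "expectation (\<lambda>\<omega>. Re (indicator A (U \<omega>) * g \<omega>)) = expectation (\<lambda>\<omega>. indicator A (U \<omega>) * Re (g \<omega>))"
        by (simp add: ind)
      then show ?thesis
        using re unfolding integral_Re[OF iA] integral_Re[OF ig(1)] by simp
    qed
    show "Im (CLINT \<omega>|M. indicator A (U \<omega>) * g \<omega>) = Im (prob {\<omega>\<in>space M. U \<omega> \<in> A} * (CLINT \<omega>|M. g \<omega>))"
    proof -
      have "expectation (\<lambda>\<omega>. Im (indicator A (U \<omega>) * g \<omega>)) = expectation (\<lambda>\<omega>. indicator A (U \<omega>) * Im (g \<omega>))"
        by (simp add: ind)
      then show ?thesis
        using im unfolding integral_Im[OF iA] integral_Im[OF ig(1)] by simp
    qed
  qed
qed

text \<open>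
  A factor \<open>iexp (s i * W i)\<close> of the product is replaced by an indicator \<open>W i \<in> A i\<close> one index at a
  time: conditionally on the remaining factors, which act as a weight, this is uniqueness of
  one-dimensional characteristic functions.
\<close>

theorem (in prob_space) indep_vars_if_char_prod:
  fixes W :: "'i \<Rightarrow> 'a \<Rightarrow> real"
  assumes fin: "finite I" and rv: "\<And>i. i \<in> I \<Longrightarrow> random_variable borel (W i)"
    and char: "\<And>s. (CLINT \<omega>|M. \<Prod>i\<in>I. iexp (s i * W i \<omega>)) = (\<Prod>i\<in>I. CLINT \<omega>|M. iexp (s i * W i \<omega>))"
  shows "indep_vars (\<lambda>_. borel) W I"
proof -
  \<comment> \<open>The empty \<open>J\<close> is the hypothesis \<open>char\<close>. The
    frequencies \<open>s\<close> stay general in the induction, since the induction hypothesis is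
    used both at \<open>s(k := t)\<close> and at the negated frequencies.\<close>
  have mixed: "(CLINT \<omega>|M. (\<Prod>i\<in>J. indicator (A i) (W i \<omega>)) * (\<Prod>i\<in>I - J. iexp (s i * W i \<omega>)))
      = (\<Prod>i\<in>J. prob {\<omega>\<in>space M. W i \<omega> \<in> A i}) * (\<Prod>i\<in>I - J. CLINT \<omega>|M. iexp (s i * W i \<omega>))"
    if "finite J" "J \<subseteq> I" "\<forall>i\<in>J. A i \<in> sets borel" for J A s
    using that
  proof (induction J arbitrary: s rule: finite_induct)
    case empty
    then show ?case using char by simp
  next
    case (insert k J)
    \<comment> \<open>\<open>g s\<close> collects all factors except that of \<open>k\<close> and
      serves as the weight for \<open>W k\<close>; \<open>G s\<close> is the value that its
      expectation will have.\<close>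
    define g where "g s \<omega> = (\<Prod>i\<in>J. indicator (A i) (W i \<omega>)) * (\<Prod>i\<in>I - insert k J. iexp (s i * W i \<omega>))"
      for s \<omega>
    define G where "G s = (\<Prod>i\<in>J. prob {\<omega>\<in>space M. W i \<omega> \<in> A i}) * (\<Prod>i\<in>I - insert k J. CLINT \<omega>|M. iexp (s i * W i \<omega>))"
      for s
    have k: "k \<in> I" and IJ: "I - J = insert k (I - insert k J)" using insert by auto
    have A[measurable]: "A i \<in> sets borel" if "i \<in> J" for i using insert that by auto
    have [measurable]: "random_variable borel (W i)" if "i \<in> J" for i using rv insert that by auto
    have Ak[measurable]: "A k \<in> sets borel" using insert by auto
    have Wk[measurable]: "random_variable borel (W k)" using rv k by auto
    have IH: "(CLINT \<omega>|M. iexp (t * W k \<omega>) * g s \<omega>) = (CLINT \<omega>|M. iexp (t * W k \<omega>)) * G s" for t s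
    proof -
      have "(CLINT \<omega>|M. (\<Prod>i\<in>J. indicator (A i) (W i \<omega>)) * (\<Prod>i\<in>I - J. iexp ((s(k:=t)) i * W i \<omega>)))
        = (\<Prod>i\<in>J. prob {\<omega>\<in>space M. W i \<omega> \<in> A i}) * (\<Prod>i\<in>I - J. CLINT \<omega>|M. iexp ((s(k:=t)) i * W i \<omega>))"
        using insert by (intro insert.IH) auto
      moreover have "(\<Prod>i\<in>I - J. iexp ((s(k:=t)) i * W i \<omega>)) = iexp (t * W k \<omega>) * (\<Prod>i\<in>I - insert k J. iexp (s i * W i \<omega>))" for \<omega>
        unfolding IJ using fin by (subst prod.insert) (auto intro!: prod.cong arg_cong2[where f="(*)"])
      moreover have "(\<Prod>i\<in>I - J. CLINT \<omega>|M. iexp ((s(k:=t)) i * W i \<omega>))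
          = (CLINT \<omega>|M. iexp (t * W k \<omega>)) * (\<Prod>i\<in>I - insert k J. CLINT \<omega>|M. iexp (s i * W i \<omega>))"
        unfolding IJ using fin by (subst prod.insert) (auto intro!: prod.cong arg_cong2[where f="(*)"])
      ultimately show ?thesis by (simp add: g_def G_def ac_simps)
    qed
    \<comment> \<open>At \<open>t = 0\<close> the factor of \<open>k\<close> is 1, which leaves the
      mean of the weight.\<close>
    have Eg: "(CLINT \<omega>|M. g s \<omega>) = G s" for s using IH[of 0 s] by (simp add: prob_space)
    \<comment> \<open>Conjugation only negates the frequencies, so the factorization for the
      conjugate weight is another instance of \<open>IH\<close>.\<close>
    have gcnj: "cnj (g s \<omega>) = g (\<lambda>i. - s i) \<omega>" for s \<omega>
      unfolding g_def by (simp add: exp_cnj indicator_def of_bool_def if_distrib[of cnj] cong: if_cong)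
    have bd: "norm (g s \<omega>) \<le> 1" for s \<omega>
    proof -
      have "norm (g s \<omega>) = (\<Prod>i\<in>J. norm (indicator (A i) (W i \<omega>) :: complex))"
        by (simp add: g_def norm_mult prod_norm[symmetric])
      also have "\<dots> \<le> 1" by (intro prod_le_1) (auto simp: indicator_def)
      finally show ?thesis .
    qed
    have [measurable]: "random_variable borel (W i)" if "i \<in> I - insert k J" for i using rv that by auto
    have gm[measurable]: "random_variable borel (g s)" for s
      unfolding g_def by measurable
    have "(CLINT \<omega>|M. indicator (A k) (W k \<omega>) * g s \<omega>) = prob {\<omega>\<in>space M. W k \<omega> \<in> A k} * (CLINT \<omega>|M. g s \<omega>)"
      by (rule weighted_char_imp_factorization_complex)
        (simp_all only: gcnj IH Eg bd Wk gm Ak)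
    then show ?case unfolding Eg unfolding g_def G_def using insert.hyps by (simp add: mult.assoc)
  qed
  show ?thesis
    unfolding indep_vars_def2
  proof (intro conjI ballI indep_setsI rv)
    fix F J assume J: "J \<noteq> {}" "J \<subseteq> I" "finite J"
      and F: "\<forall>j\<in>J. F j \<in> {W j -` A \<inter> space M |A. A \<in> sets borel}"
    then obtain A where A: "\<And>j. j \<in> J \<Longrightarrow> F j = W j -` A j \<inter> space M" "\<And>j. j \<in> J \<Longrightarrow> A j \<in> sets borel"
      by (auto simp: Ball_def) metis
    have Fj: "F j = {\<omega>\<in>space M. W j \<omega> \<in> A j}" if "j \<in> J" for j using A(1)[OF that] by auto
    have Fm: "F j \<in> events" if "j \<in> J" for j
      unfolding A(1)[OF that] using A(2)[OF that] rv J that by (auto intro!: measurable_sets)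
    have FJ: "(\<Inter>j\<in>J. F j) \<in> events" using J Fm by (intro sets.finite_INT) auto
    have "complex_of_real (prob (\<Inter>j\<in>J. F j)) = (CLINT \<omega>|M. complex_of_real (indicator (\<Inter>j\<in>J. F j) \<omega>))"
      using sets.sets_into_space[OF FJ] by (simp only: integral_complex_of_real Bochner_Integration.integral_indicator Int_absorb2)
    also have "\<dots> = (CLINT \<omega>|M. (\<Prod>i\<in>J. indicator (A i) (W i \<omega>)))"
      using J by (intro Bochner_Integration.integral_cong refl)
        (auto simp: Fj indicator_def prod.If_cases)
    \<comment> \<open>With all frequencies 0 only the indicators remain in
      \<open>mixed\<close>.\<close>
    also have "\<dots> = (\<Prod>i\<in>J. prob (F i))"
      using mixed[of J A "\<lambda>_. 0"] J A by (simp add: prob_space Fj)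
    finally show "prob (\<Inter>j\<in>J. F j) = (\<Prod>j\<in>J. prob (F j))" by (metis of_real_eq_iff of_real_prod)
  next
    fix i assume "i \<in> I"
    then show "{W i -` A \<inter> space M |A. A \<in> sets borel} \<subseteq> events"
      using rv by (auto intro!: measurable_sets)
  qed
qed

subsection \<open>Simes' inequality\<close>

text \<open>Let \<open>r\<close> be the number of rejections of the step-up test and give each
  rejected index the weight \<open>1 / r\<close>, so that the weights sum to at least 1 on the
  rejection event. For fixed \<open>j\<close>, the event that \<open>r\<close> is the count can be
  replaced by one that is independent of \<open>p j\<close>; superuniformity then gives the factor
  \<open>c r / r\<close>, which is \<open>\<alpha> / N\<close> for every \<open>r\<close>. The
  replaced events are disjoint in \<open>r\<close>, so each \<open>j\<close> contributes at most
  \<open>\<alpha> / N\<close>.\<close>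

lemma (in prob_space) simes_inequality:
  fixes p :: "'i \<Rightarrow> 'a \<Rightarrow> real"
  assumes fin: "finite I" and ind: "indep_vars (\<lambda>_. borel) p I"
    and super: "\<And>j u. j \<in> I \<Longrightarrow> 0 \<le> u \<Longrightarrow> u \<le> 1 \<Longrightarrow> prob {\<omega>\<in>space M. p j \<omega> \<le> u} \<le> u"
    and \<alpha>: "0 \<le> \<alpha>" "\<alpha> \<le> 1"
  shows "prob {\<omega>\<in>space M. \<exists>v\<ge>1. v \<le> card {j\<in>I. p j \<omega> \<le> real v * \<alpha> / real (card I)}} \<le> \<alpha>"
proof -
  define N where "N = card I"
  define c where "c v = real v * \<alpha> / real N" for v
  \<comment> \<open>\<open>D I 0 r\<close> says that \<open>r\<close> is the largest number of rejections of the step-up test. On \<open>p j \<le> c r\<close>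
    it agrees with \<open>D (I - {j}) 1 r\<close>, which does not depend on \<open>p j\<close>.\<close>
  define C where "C K v f = (\<Sum>i\<in>K. indicator {..c v} (f i :: real) :: real)" for K :: "'i set" and v and f
  define D where "D K a r f \<longleftrightarrow> real r \<le> a + C K r f \<and> (\<forall>v\<in>{r<..N}. a + C K v f < real v)" for K a r f
  define E where "E r = {\<omega>\<in>space M. D I 0 r (\<lambda>i. p i \<omega>)}" for r
  define F where "F j r = {\<omega>\<in>space M. D (I - {j}) 1 r (\<lambda>i. p i \<omega>)}" for j r
  define P where "P j r = {\<omega>\<in>space M. p j \<omega> \<le> c r}" for j r
  define S where "S = {\<omega>\<in>space M. \<exists>v\<ge>1. v \<le> card {j\<in>I. p j \<omega> \<le> real v * \<alpha> / real (card I)}}"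
  have rv[measurable]: "p j \<in> borel_measurable M" if "j \<in> I" for j
    using ind that by (auto simp: indep_vars_def)
  have Ccard: "C K v f = real (card {j\<in>K. f j \<le> c v})" if "K \<subseteq> I" for K v f
  proof -
    have "{j\<in>K. f j \<le> c v} = K \<inter> {j. f j \<le> c v}" by auto
    then show ?thesis
      using finite_subset[OF that fin] by (simp add: C_def indicator_def sum.If_cases)
  qed
  have cmono: "c r \<le> c v" if "r \<le> v" for r v
    using that \<alpha> by (simp add: c_def divide_right_mono mult_right_mono)
  have CI: "C I v f = indicator {..c v} (f j) + C (I - {j}) v f" if "j \<in> I" for j v f
    unfolding C_def using that fin by (simp add: sum.remove)
  have measD: "Measurable.pred (PiM K (\<lambda>_. borel)) (D K a r)" if "K \<subseteq> I" for K a r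
    unfolding D_def C_def by measurable
  have E[measurable]: "E r \<in> sets M" for r unfolding E_def D_def C_def by measurable
  have F[measurable]: "F j r \<in> sets M" for j r unfolding F_def D_def C_def by measurable
  have P[measurable]: "P j r \<in> sets M" if "j \<in> I" for j r unfolding P_def using that by measurable
  \<comment> \<open>\<open>D\<close> looks only at thresholds \<open>c v\<close> with
    \<open>v\<close> at least \<open>r\<close>. If \<open>p j\<close> is below \<open>c r\<close>,
    it is below all of these, so index \<open>j\<close> adds exactly the constant 1 to each
    count.\<close>
  have EF: "E r \<inter> P j r = F j r \<inter> P j r" if "j \<in> I" for j r
  proof -
    have "D I 0 r f \<longleftrightarrow> D (I - {j}) 1 r f" if "f j \<le> c r" for f
    proof -
      have "C I v f = 1 + C (I - {j}) v f" if "r \<le> v" for v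
        using cmono[OF that] \<open>f j \<le> c r\<close> CI[OF \<open>j \<in> I\<close>] by simp
      then show ?thesis unfolding D_def by auto
    qed
    then show ?thesis unfolding E_def F_def P_def by auto
  qed
  \<comment> \<open>\<open>F j r\<close> is determined by the coordinates other than
    \<open>j\<close>, and \<open>P j r\<close> by coordinate \<open>j\<close> alone; disjoint blocks
    of an independent family are independent.\<close>
  have indep: "prob (F j r \<inter> P j r) = prob (F j r) * prob (P j r)" if j: "j \<in> I" for j r
  proof -
    have "indep_var (PiM (I - {j}) (\<lambda>_. borel)) (\<lambda>\<omega>. restrict (\<lambda>i. p i \<omega>) (I - {j}))
       (PiM {j} (\<lambda>_. borel)) (\<lambda>\<omega>. restrict (\<lambda>i. p i \<omega>) {j})"
      using j by (intro indep_var_restrict[OF ind]) auto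
    from indep_varD[OF this, of "{f\<in>space (PiM (I - {j}) (\<lambda>_. borel)). D (I - {j}) 1 r f}"
        "{f\<in>space (PiM {j} (\<lambda>_. borel)). f j \<le> c r}"]
    have "prob ((\<lambda>\<omega>. (restrict (\<lambda>i. p i \<omega>) (I - {j}), restrict (\<lambda>i. p i \<omega>) {j})) -`
       ({f\<in>space (PiM (I - {j}) (\<lambda>_. borel)). D (I - {j}) 1 r f} \<times>
        {f\<in>space (PiM {j} (\<lambda>_. borel)). f j \<le> c r}) \<inter> space M)
      = prob ((\<lambda>\<omega>. restrict (\<lambda>i. p i \<omega>) (I - {j})) -` {f\<in>space (PiM (I - {j}) (\<lambda>_. borel)). D (I - {j}) 1 r f} \<inter> space M)
      * prob ((\<lambda>\<omega>. restrict (\<lambda>i. p i \<omega>) {j}) -` {f\<in>space (PiM {j} (\<lambda>_. borel)). f j \<le> c r} \<inter> space M)"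
      using measD[of "I - {j}" 1 r] by auto
    moreover have "D (I - {j}) 1 r (restrict f (I - {j})) = D (I - {j}) 1 r f" for f
      by (simp add: D_def C_def)
    ultimately show ?thesis
      by (simp add: F_def P_def vimage_def space_PiM Int_def conj_ac)
  qed
  \<comment> \<open>Only the summand of the largest admissible \<open>r\<close> is kept: there at
    least \<open>r\<close> indices lie below \<open>c r\<close>, each with weight
    \<open>1 / r\<close>.\<close>
  have cover: "indicator S \<omega>
      \<le> (\<Sum>r=1..N. \<Sum>j\<in>I. indicator (E r \<inter> P j r) \<omega> / real r)" (is "_ \<le> ?rhs") for \<omega>
  proof (cases "\<omega> \<in> S")
    case True
    then have \<omega>: "\<omega> \<in> space M" by (simp add: S_def)
    define f where "f = (\<lambda>i. p i \<omega>)"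
    define V where "V = {v. 1 \<le> v \<and> v \<le> N \<and> real v \<le> C I v f}"
    have "finite V" by (rule finite_subset[of _ "{..N}"]) (auto simp: V_def)
    have "V \<noteq> {}"
    proof -
      from True[unfolded S_def] obtain v where v: "v \<ge> 1" "v \<le> card {j\<in>I. p j \<omega> \<le> c v}"
        by (auto simp: c_def N_def)
      moreover have "card {j\<in>I. p j \<omega> \<le> c v} \<le> N" unfolding N_def using fin by (intro card_mono) auto
      ultimately have "v \<in> V" by (auto simp: V_def Ccard f_def)
      then show ?thesis by auto
    qed
    define r where "r = Max V"
    have rV: "r \<in> V" unfolding r_def using \<open>finite V\<close> \<open>V \<noteq> {}\<close> by (rule Max_in)
    have mx: "v \<le> r" if "v \<in> V" for v unfolding r_def using \<open>finite V\<close> that by (rule Max_ge)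
    have r: "1 \<le> r" "r \<le> N" "real r \<le> C I r f" using rV by (auto simp: V_def)
    have "D I 0 r f" 
      unfolding D_def
    proof (intro conjI ballI)
      fix v assume v: "v \<in> {r<..N}"
      then have "v \<notin> V" using mx[of v] by auto
      then show "0 + C I v f < real v" using v r by (simp add: V_def)
    qed (use r in simp)
    then have er: "\<omega> \<in> E r" using \<omega> by (simp add: E_def f_def)
    have "1 \<le> C I r f / real r" using r by simp
    also have "C I r f / real r = (\<Sum>j\<in>I. indicator (E r \<inter> P j r) \<omega> / real r)"
      unfolding C_def sum_divide_distrib
      by (intro sum.cong) (use \<omega> er in \<open>auto simp: indicator_def P_def f_def\<close>)
    also have "\<dots> \<le> ?rhs"
      using r by (intro member_le_sum[of r "{1..N}" "\<lambda>r. \<Sum>j\<in>I. indicator (E r \<inter> P j r) \<omega> / real r"])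
        (auto intro!: sum_nonneg)
    finally show ?thesis using True by simp
  qed (auto intro!: sum_nonneg)
  \<comment> \<open>For \<open>r < s\<close>, \<open>F j r\<close> demands
    \<open>1 + C (I - {j}) s f < s\<close>, whereas \<open>F j s\<close> demands the opposite
    inequality.\<close>
  have disj: "(\<Sum>r=1..N. prob (F j r)) \<le> 1" if "j \<in> I" for j
  proof -
    have "disjoint_family_on (F j) {1..N}"
      unfolding disjoint_family_on_def
    proof (intro ballI impI)
      have "F j r \<inter> F j s = {}" if "r < s" "s \<in> {1..N}" for r s
        using that by (force simp: F_def D_def)
      then show "F j r \<inter> F j s = {}" if "r \<in> {1..N}" "s \<in> {1..N}" "r \<noteq> s" for r s
        using that by (metis Int_commute linorder_neqE_nat)
    qed
    then have "(\<Sum>r=1..N. prob (F j r)) = prob (\<Union>r\<in>{1..N}. F j r)"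
      by (intro finite_measure_finite_Union[symmetric]) auto
    then show ?thesis by simp
  qed
  have S[measurable]: "S \<in> sets M"
  proof -
    have "S = {\<omega>\<in>space M. \<exists>v\<ge>1. real v \<le> C I v (\<lambda>i. p i \<omega>)}"
      by (simp add: S_def Ccard c_def N_def)
    also have "\<dots> \<in> sets M" unfolding C_def by measurable
    finally show ?thesis .
  qed
  have "prob S = expectation (indicator S)" by simp
  also have "\<dots> \<le> expectation (\<lambda>\<omega>. \<Sum>r=1..N. \<Sum>j\<in>I. indicator (E r \<inter> P j r) \<omega> / real r)"
    by (intro integral_mono cover Bochner_Integration.integrable_sum integrable_divide_zero integrable_real_indicator)
       (auto simp: emeasure_eq_measure)
  also have "\<dots> = (\<Sum>r=1..N. \<Sum>j\<in>I. prob (E r \<inter> P j r) / real r)"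
    by (simp add: Bochner_Integration.integral_sum emeasure_eq_measure less_top[symmetric] Int_assoc)
  also have "\<dots> \<le> (\<Sum>r=1..N. \<Sum>j\<in>I. prob (F j r) * (\<alpha> / real N))"
  proof (intro sum_mono)
    fix r j assume r: "r \<in> {1..N}" and j: "j \<in> I"
    \<comment> \<open>The threshold must lie in the unit interval for \<open>super\<close> to apply
      to it.\<close>
    have "c r \<le> 1" "0 \<le> c r" using r \<alpha> mult_mono[of "real r" "real N" \<alpha> 1] by (auto simp: c_def field_simps)
    then have "prob (P j r) \<le> c r" unfolding P_def using j by (intro super) auto
    then have "prob (E r \<inter> P j r) / real r \<le> prob (F j r) * c r / real r"
      unfolding EF[OF j] indep[OF j] by (intro divide_right_mono mult_left_mono) auto
    then show "prob (E r \<inter> P j r) / real r \<le> prob (F j r) * (\<alpha> / real N)"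
      using r by (simp add: c_def)
  qed
  also have "\<dots> = (\<Sum>j\<in>I. (\<Sum>r=1..N. prob (F j r)) * (\<alpha> / real N))"
    by (subst sum.swap) (simp only: sum_distrib_right)
  also have "\<dots> \<le> (\<Sum>j\<in>I. 1 * (\<alpha> / real N))"
    using \<alpha> by (intro sum_mono mult_right_mono disj) auto
  also have "\<dots> \<le> \<alpha>" using \<alpha> by (cases "N = 0") (auto simp: N_def)
  finally show ?thesis unfolding S_def .
qed

subsection \<open>Gaussian noise and orthonormal columns\<close>

definition gaussian :: "real \<Rightarrow> real measure" where
  "gaussian \<sigma> = density lborel (normal_density 0 \<sigma>)"

lemma prob_space_gaussian: "0 < \<sigma> \<Longrightarrow> prob_space (gaussian \<sigma>)"
  unfolding gaussian_def by (rule prob_space_normal_density)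

lemma gaussian_scaled_std:
  assumes "0 < \<sigma>"
  shows "gaussian \<sigma> = distr std_normal_distribution borel (\<lambda>x. \<sigma> * x)"
proof -
  interpret real_distribution std_normal_distribution by (rule real_dist_normal_dist)
  have "distributed std_normal_distribution lborel (\<lambda>x. x) std_normal_density"
    by (simp add: distributed_def distr_id2 cong: distr_cong)
  from normal_density_affine[OF this, of \<sigma> 0] assms
  have "distributed std_normal_distribution lborel (\<lambda>x. \<sigma> * x) (normal_density 0 \<sigma>)"
    by simp
  from distributed_distr_eq_density[OF this] show ?thesis
    by (simp add: gaussian_def cong: distr_cong)
qed

lemma char_gaussian:
  assumes "0 < \<sigma>"
  shows "char (gaussian \<sigma>) t = exp (- (\<sigma> * t)\<^sup>2 / 2)"
proof -
  have "char (gaussian \<sigma>) t = (CLINT x|std_normal_distribution. iexp (t * (\<sigma> * x)))"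
    unfolding gaussian_scaled_std[OF assms] char_def by (subst integral_distr) auto
  also have "\<dots> = char std_normal_distribution (\<sigma> * t)"
    unfolding char_def by (simp add: ac_simps)
  finally show ?thesis by (simp add: char_std_normal_distribution)
qed

lemma prob_space_noise: "0 < \<sigma> \<Longrightarrow> prob_space (noise_dist n \<sigma>)"
  unfolding noise_dist_def by (intro prob_space_PiM prob_space_normal_density)

lemma measurable_column_noise [measurable]:
  "(\<lambda>\<epsilon>. \<Sum>l<n. X l j * \<epsilon> l) \<in> borel_measurable (noise_dist n \<sigma>)"
  unfolding noise_dist_def by measurable

text \<open>The noise has a product law, so the expectation is a product of one-dimensional Gaussian
  characteristic functions at the frequencies \<open>c l\<close>.\<close>

lemma integral_iexp_linear_noise:
  assumes "0 < \<sigma>"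
  shows "(CLINT \<epsilon>|noise_dist n \<sigma>. iexp (\<Sum>l<n. c l * \<epsilon> l)) = exp (- \<sigma>\<^sup>2 * (\<Sum>l<n. (c l)\<^sup>2) / 2)"
proof -
  interpret G: prob_space "gaussian \<sigma>" using assms by (rule prob_space_gaussian)
  interpret product_sigma_finite "\<lambda>_::nat. gaussian \<sigma>" ..
  have [measurable_cong]: "sets (gaussian \<sigma>) = sets borel" by (simp add: gaussian_def)
  have "(CLINT \<epsilon>|noise_dist n \<sigma>. iexp (\<Sum>l<n. c l * \<epsilon> l))
      = (CLINT \<epsilon>|PiM {..<n} (\<lambda>_. gaussian \<sigma>). \<Prod>l<n. iexp (c l * \<epsilon> l))"
    by (simp add: noise_dist_def gaussian_def[symmetric] exp_sum sum_distrib_left)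
  also have "\<dots> = (\<Prod>l<n. char (gaussian \<sigma>) (c l))"
    unfolding char_def
    by (intro product_integral_prod G.integrable_const_bound[of _ 1]) auto
  also have "\<dots> = exp (\<Sum>l<n. - (\<sigma> * c l)\<^sup>2 / 2)"
    by (simp add: char_gaussian[OF assms] exp_sum)
  also have "(\<Sum>l<n. - (\<sigma> * c l)\<^sup>2 / 2) = - \<sigma>\<^sup>2 * (\<Sum>l<n. (c l)\<^sup>2) / 2"
    by (simp add: power_mult_distrib sum_distrib_left sum_negf sum_divide_distrib)
  finally show ?thesis .
qed

section \<open>Orthonormal columns applied to the noise\<close>

lemma sum_squares_orthonormal_combination:
  fixes X :: "nat \<Rightarrow> nat \<Rightarrow> real"
  assumes fin: "finite J"
    and orth: "\<And>j l. j \<in> J \<Longrightarrow> l \<in> J \<Longrightarrow> (\<Sum>i<n. X i j * X i l) = (if j = l then 1 else 0)"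
  shows "(\<Sum>i<n. (\<Sum>j\<in>J. s j * X i j)\<^sup>2) = (\<Sum>j\<in>J. (s j)\<^sup>2)"
proof -
  have "(\<Sum>i<n. (\<Sum>j\<in>J. s j * X i j)\<^sup>2) = (\<Sum>i<n. \<Sum>j\<in>J. \<Sum>l\<in>J. s j * s l * (X i j * X i l))"
    by (simp add: power2_eq_square sum_product ac_simps)
  also have "\<dots> = (\<Sum>j\<in>J. \<Sum>i<n. \<Sum>l\<in>J. s j * s l * (X i j * X i l))"
    by (rule sum.swap)
  also have "\<dots> = (\<Sum>j\<in>J. \<Sum>l\<in>J. \<Sum>i<n. s j * s l * (X i j * X i l))"
    by (intro sum.cong refl sum.swap)
  also have "\<dots> = (\<Sum>j\<in>J. \<Sum>l\<in>J. if j = l then s j * s l else 0)"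
    by (intro sum.cong refl) (simp add: sum_distrib_left[symmetric] orth)
  also have "\<dots> = (\<Sum>j\<in>J. (s j)\<^sup>2)" using fin by (simp add: power2_eq_square)
  finally show ?thesis .
qed

context
  fixes n :: nat and X :: "nat \<Rightarrow> nat \<Rightarrow> real" and \<sigma> :: real and J :: "nat set"
  assumes fin: "finite J" and \<sigma>: "0 < \<sigma>"
    and orth: "\<And>j l. j \<in> J \<Longrightarrow> l \<in> J \<Longrightarrow> (\<Sum>i<n. X i j * X i l) = (if j = l then 1 else 0)"
begin

text \<open>The exponents add up to a single linear form in the noise. By orthonormality the squared
  norm of its coefficients is the sum of the \<open>(s j)^2\<close>, so the Gaussian exponential
  splits over \<open>J\<close>.\<close>

lemma integral_iexp_columns_noise:
  "(CLINT \<epsilon>|noise_dist n \<sigma>. \<Prod>j\<in>J. iexp (s j * (\<Sum>l<n. X l j * \<epsilon> l)))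
    = (\<Prod>j\<in>J. exp (- (\<sigma> * s j)\<^sup>2 / 2))"
proof -
  have "(\<Prod>j\<in>J. iexp (s j * (\<Sum>l<n. X l j * \<epsilon> l))) = iexp (\<Sum>l<n. (\<Sum>j\<in>J. s j * X l j) * \<epsilon> l)" for \<epsilon>
  proof -
    have "(\<Prod>j\<in>J. iexp (s j * (\<Sum>l<n. X l j * \<epsilon> l))) = iexp (\<Sum>j\<in>J. s j * (\<Sum>l<n. X l j * \<epsilon> l))"
      using fin by (simp add: exp_sum sum_distrib_left)
    also have "(\<Sum>j\<in>J. s j * (\<Sum>l<n. X l j * \<epsilon> l)) = (\<Sum>l<n. (\<Sum>j\<in>J. s j * X l j) * \<epsilon> l)"
      by (simp add: sum_distrib_left sum_distrib_right sum.swap[of _ "{..<n}"] mult.assoc)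
    finally show ?thesis .
  qed
  then have "(CLINT \<epsilon>|noise_dist n \<sigma>. \<Prod>j\<in>J. iexp (s j * (\<Sum>l<n. X l j * \<epsilon> l)))
      = exp (- \<sigma>\<^sup>2 * (\<Sum>j\<in>J. (s j)\<^sup>2) / 2)"
    by (simp only: integral_iexp_linear_noise[OF \<sigma>] sum_squares_orthonormal_combination[OF fin orth])
  also have "- \<sigma>\<^sup>2 * (\<Sum>j\<in>J. (s j)\<^sup>2) / 2 = (\<Sum>j\<in>J. - (\<sigma> * s j)\<^sup>2 / 2)"
    by (simp add: power_mult_distrib sum_distrib_left sum_negf sum_divide_distrib)
  finally show ?thesis using fin by (simp add: exp_sum)
qed

lemma integral_iexp_column_noise:
  assumes "j \<in> J"
  shows "(CLINT \<epsilon>|noise_dist n \<sigma>. iexp (t * (\<Sum>l<n. X l j * \<epsilon> l))) = exp (- (\<sigma> * t)\<^sup>2 / 2)"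
proof -
  \<comment> \<open>The joint formula is applied with frequency \<open>t\<close> at \<open>j\<close>
    and 0 elsewhere; all other factors are then 1 on both sides.\<close>
  have "(\<Prod>i\<in>J. f (if i = j then t else 0) i) = f t j"
    if "\<And>i. f 0 i = 1" for f :: "real \<Rightarrow> nat \<Rightarrow> complex"
  proof -
    have "(\<Prod>i\<in>J. f (if i = j then t else 0) i) = (\<Prod>i\<in>J. if i = j then f t j else 1)"
      using that by (intro prod.cong) auto
    then show ?thesis using fin assms by simp
  qed
  from this[of "\<lambda>s i. iexp (s * (\<Sum>l<n. X l i * _ l))"] this[of "\<lambda>s i. exp (- (\<sigma> * s)\<^sup>2 / 2)"]
    integral_iexp_columns_noise[of "\<lambda>i. if i = j then t else 0"]
  show ?thesis by simp
qed

lemma distr_column_noise: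
  assumes "j \<in> J"
  shows "distr (noise_dist n \<sigma>) borel (\<lambda>\<epsilon>. \<Sum>l<n. X l j * \<epsilon> l) = gaussian \<sigma>"
proof (rule Levy_uniqueness)
  interpret prob_space "noise_dist n \<sigma>" using \<sigma> by (rule prob_space_noise)
  show "real_distribution (distr (noise_dist n \<sigma>) borel (\<lambda>\<epsilon>. \<Sum>l<n. X l j * \<epsilon> l))"
    by (rule real_distribution_distr) measurable
  show "real_distribution (gaussian \<sigma>)"
    using prob_space_gaussian[OF \<sigma>]
    by (simp add: real_distribution_def real_distribution_axioms_def gaussian_def)
  show "char (distr (noise_dist n \<sigma>) borel (\<lambda>\<epsilon>. \<Sum>l<n. X l j * \<epsilon> l)) = char (gaussian \<sigma>)"
  proof
    fix t
    show "char (distr (noise_dist n \<sigma>) borel (\<lambda>\<epsilon>. \<Sum>l<n. X l j * \<epsilon> l)) t = char (gaussian \<sigma>) t"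
      unfolding char_gaussian[OF \<sigma>] integral_iexp_column_noise[OF assms, symmetric]
      unfolding char_def by (subst integral_distr) auto
  qed
qed

end

subsection \<open>The standard normal distribution function\<close>

interpretation std_normal: real_distribution std_normal_distribution
  by (rule real_dist_normal_dist)

lemma Phi_eq_cdf: "Phi x = cdf std_normal_distribution x"
  by (simp add: Phi_def cdf_def)

lemma std_normal_singleton: "measure std_normal_distribution {x} = 0"
proof -
  have "AE y in lborel. y \<noteq> x" by (rule AE_lborel_singleton)
  then have "emeasure std_normal_distribution {x} = 0"
    by (subst emeasure_density) (auto intro!: nn_integral_zero' elim!: eventually_mono simp: indicator_def)
  then show ?thesis by (simp add: measure_def)
qed

lemma isCont_Phi: "isCont Phi x"
  using std_normal.isCont_cdf[of x] std_normal_singleton[of x]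
  by (simp add: Phi_eq_cdf[abs_def])

text \<open>The density is positive everywhere, so an interval of mass 0 would have Lebesgue measure
  0.\<close>

lemma Phi_strict_mono: "strict_mono Phi"
proof (rule strict_monoI)
  fix x y :: real assume "x < y"
  have "emeasure std_normal_distribution {x<..y} \<noteq> 0"
  proof
    assume "emeasure std_normal_distribution {x<..y} = 0"
    then have "AE z in lborel. ennreal (std_normal_density z) * indicator {x<..y} z = 0"
      by (simp add: emeasure_density nn_integral_0_iff_AE)
    then have "AE z in lborel. z \<notin> {x<..y}"
      by (rule eventually_mono)
        (use normal_density_pos[of 1 0] in \<open>auto simp: indicator_def less_le split: if_splits\<close>)
    then have "emeasure lborel {x<..y} = 0"
      by (subst (asm) AE_iff_measurable[of "{x<..y}"]) auto
    then show False using \<open>x < y\<close> by simp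
  qed
  then have "0 < measure std_normal_distribution {x<..y}"
    by (simp add: std_normal.emeasure_eq_measure zero_less_measure_iff)
  then show "Phi x < Phi y"
    using std_normal.cdf_diff_eq[OF \<open>x < y\<close>] by (simp add: Phi_eq_cdf)
qed

lemma Phi_less_1: "Phi x < 1"
  using strict_monoD[OF Phi_strict_mono, of x "x + 1"] std_normal.cdf_bounded_prob[of "x + 1"]
  by (simp add: Phi_eq_cdf)

text \<open>The limits at both ends and continuity give a preimage, and strict monotonicity makes it
  unique, so the description in \<open>Phi_inv\<close> denotes it.\<close>

lemma Phi_Phi_inv:
  assumes "0 < p" "p < 1"
  shows "Phi (Phi_inv p) = p"
proof -
  have "eventually (\<lambda>x. Phi x < p) at_bot"
    unfolding Phi_eq_cdf using assms by (intro order_tendstoD[OF std_normal.cdf_lim_at_bot])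
  then obtain a where a: "Phi a < p" by (auto simp: eventually_at_bot_linorder)
  have "eventually (\<lambda>x. p < Phi x) at_top"
    unfolding Phi_eq_cdf using assms by (intro order_tendstoD[OF std_normal.cdf_lim_at_top_prob])
  then obtain b where b: "p < Phi b" by (auto simp: eventually_at_top_linorder)
  have "a \<le> b" using a b strict_mono_less_eq[OF Phi_strict_mono, of b a] by linarith
  then obtain x where "Phi x = p"
    using IVT[of Phi a p b] a b isCont_Phi by (meson less_imp_le)
  then have "\<exists>!x. Phi x = p" using strict_mono_eq[OF Phi_strict_mono] by metis
  then show ?thesis unfolding Phi_inv_def by (rule theI')
qed

lemma Phi_inv_mono:
  assumes "0 < p" "p \<le> q" "q < 1"
  shows "Phi_inv p \<le> Phi_inv q"
  using assms strict_mono_less_eq[OF Phi_strict_mono, of "Phi_inv p" "Phi_inv q"]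
  by (simp add: Phi_Phi_inv)

text \<open>Negation preserves the standard normal law and turns the upper tail into a lower
  one.\<close>

lemma measure_std_normal_atLeast: "measure std_normal_distribution {x..} = Phi (- x)"
proof -
  have "std_normal_distribution = distr std_normal_distribution borel uminus"
  proof -
    have "distributed std_normal_distribution lborel (\<lambda>x. x) std_normal_density"
      by (simp add: distributed_def distr_id2 cong: distr_cong)
    from std_normal.normal_density_affine[OF this, of "-1" 0]
    have "distributed std_normal_distribution lborel uminus std_normal_density" by simp
    from distributed_distr_eq_density[OF this] show ?thesis
      by (simp cong: distr_cong)
  qed
  then have "measure std_normal_distribution {x..} = measure (distr std_normal_distribution borel uminus) {x..}"
    by simp
  also have "\<dots> = measure std_normal_distribution (uminus -` {x..})"
    by (subst measure_distr) auto
  also have "uminus -` {x..} = {..-x}" by auto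
  finally show ?thesis by (simp add: Phi_def)
qed

lemma Phi_minus: "Phi (- x) = 1 - Phi x"
proof -
  have "measure std_normal_distribution {x..} = 1 - measure std_normal_distribution {..<x}"
    using std_normal.prob_compl[of "{..<x}"] by (simp add: Compl_eq_Diff_UNIV[symmetric] not_less)
  moreover have "measure std_normal_distribution {..x} = measure std_normal_distribution {..<x} + measure std_normal_distribution {x}"
    by (subst std_normal.finite_measure_Union[symmetric]) (auto intro!: arg_cong[where f="measure _"])
  ultimately show ?thesis
    using measure_std_normal_atLeast[of x] std_normal_singleton[of x] by (simp add: Phi_def)
qed

section \<open>Two-sided p-values\<close>

lemma borel_measurable_Phi [measurable]: "Phi \<in> borel_measurable borel"
  by (intro borel_measurable_mono strict_mono_mono Phi_strict_mono)

text \<open>A p-value of at most \<open>u\<close> puts \<open>x\<close> into one of the two tails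
  cut off at the quantile of \<open>1 - u / 2\<close>, each of mass \<open>u / 2\<close>.\<close>

lemma two_sided_p_value_superuniform:
  assumes "0 \<le> u" "u \<le> 1"
  shows "measure std_normal_distribution {x. 2 * (1 - Phi \<bar>x\<bar>) \<le> u} \<le> u"
proof (cases "u = 0 \<or> u = 1")
  case True
  then show ?thesis
  proof
    \<comment> \<open>Here \<open>1 - u / 2\<close> is 1, which is not a value of
      \<open>Phi\<close>; the event is empty because p-values are strictly positive.\<close>
    assume "u = 0"
    then have "{x. 2 * (1 - Phi \<bar>x\<bar>) \<le> u} = {}" using Phi_less_1 by (force simp: not_le)
    then show ?thesis using assms by simp
  qed simp
next
  case False
  define c where "c = Phi_inv (1 - u / 2)"
  have c: "Phi c = 1 - u / 2" unfolding c_def using assms False by (intro Phi_Phi_inv) auto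
  have "{x. 2 * (1 - Phi \<bar>x\<bar>) \<le> u} \<subseteq> {..-c} \<union> {c..}"
  proof
    fix x assume "x \<in> {x. 2 * (1 - Phi \<bar>x\<bar>) \<le> u}"
    then have "Phi c \<le> Phi \<bar>x\<bar>" by (simp add: c field_simps)
    then have "c \<le> \<bar>x\<bar>" by (simp add: strict_mono_less_eq[OF Phi_strict_mono])
    then show "x \<in> {..-c} \<union> {c..}" by auto
  qed
  then have "measure std_normal_distribution {x. 2 * (1 - Phi \<bar>x\<bar>) \<le> u}
      \<le> measure std_normal_distribution ({..-c} \<union> {c..})"
    by (intro std_normal.finite_measure_mono) auto
  also have "\<dots> \<le> measure std_normal_distribution {..-c} + measure std_normal_distribution {c..}"
    by (intro measure_Un_le) auto
  also have "\<dots> = u" using c by (simp add: measure_std_normal_atLeast Phi_minus flip: Phi_def)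
  finally show ?thesis .
qed

subsection \<open>Selection by SLOPE\<close>

text \<open>If \<open>x\<close> lands at position \<open>q\<close>, each later entry moves from
  weight \<open>l i\<close> to \<open>l (Suc i)\<close>. These entries are at most \<open>x\<close>,
  and they vanish from position \<open>r\<close> on, where \<open>r\<close> counts the nonzero
  entries. The loss is thus at most the telescoping sum \<open>(l q - l r) * x\<close>, and the gain
  \<open>l q * x\<close> leaves \<open>l r * x\<close>.\<close>

lemma weighted_sum_insort:
  fixes l :: "nat \<Rightarrow> real"
  assumes "sorted_wrt (\<ge>) xs" "\<forall>y\<in>set xs. 0 \<le> y" "0 \<le> x"
    and "\<forall>i j. i \<le> j \<longrightarrow> j \<le> length xs \<longrightarrow> l j \<le> l i"
  shows "(\<Sum>i<length xs. l i * xs ! i) + l (length (filter (\<lambda>y. y \<noteq> 0) xs)) * x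
         \<le> (\<Sum>i<Suc (length xs). l i * insort_key uminus x xs ! i)"
  using assms
proof (induction xs arbitrary: l x)
  case Nil
  then show ?case by simp
next
  case (Cons y ys)
  let ?r = "length (filter (\<lambda>y. y \<noteq> 0) ys)"
  have IH: "(\<Sum>i<length ys. l (Suc i) * ys ! i) + l (Suc ?r) * z
         \<le> (\<Sum>i<Suc (length ys). l (Suc i) * insort_key uminus z ys ! i)" if "0 \<le> z" for z
    using Cons.prems that by (intro Cons.IH) auto
  show ?case
  proof (cases "y \<le> x")
    case False
    then have "y \<noteq> 0" using Cons.prems(3) by auto
    then show ?thesis using False IH[OF Cons.prems(3)]
      by (simp add: sum.lessThan_Suc_shift del: sum.lessThan_Suc)
  next
    case True
    show ?thesis
    proof (cases "y = 0")
      case y0: True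
      with Cons.prems have z: "\<forall>u\<in>set ys. u = 0" by force
      then have "filter (\<lambda>y. y \<noteq> 0) ys = []" by (simp add: filter_empty_conv)
      moreover have "ys ! i = 0" if "i < length ys" for i using z that by auto
      ultimately show ?thesis using True y0
        by (simp add: sum.lessThan_Suc_shift del: sum.lessThan_Suc)
    next
      case y0: False
      \<comment> \<open>The induction hypothesis is used for inserting \<open>y\<close>, which stays
        at the head of \<open>ys\<close>. Having \<open>x\<close> instead of \<open>y\<close> as the
        inserted value costs nothing, by the sign of the product
        \<open>(l 0 - l (Suc ?r)) * (x - y)\<close>.\<close>
      have "insort_key uminus y ys = y # ys"
        using Cons.prems by (intro insort_is_Cons) auto
      with IH[of y] Cons.prems have *: "(\<Sum>i<length ys. l (Suc i) * ys ! i) + l (Suc ?r) * y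
         \<le> (\<Sum>i<Suc (length ys). l (Suc i) * (y # ys) ! i)" by simp
      have "l (Suc ?r) \<le> l 0" using Cons.prems(4) by simp
      then have "0 \<le> (l 0 - l (Suc ?r)) * (x - y)" using True by simp
      then show ?thesis using True y0 *
        by (simp add: sum.lessThan_Suc_shift algebra_simps del: sum.lessThan_Suc)
    qed
  qed
qed

text \<open>Let \<open>ds\<close> be the sorted absolute values of the other coordinates. Sorting
  \<open>b\<close> inserts its entry \<open>i\<close> into \<open>ds\<close>, while sorting the
  zeroed vector appends 0 to \<open>ds\<close>, so \<open>weighted_sum_insort\<close> compares the
  two penalties.\<close>

lemma sorted_abs_sum_zero_coordinate:
  fixes b :: "nat \<Rightarrow> real"
  assumes i: "i < m" "b i \<noteq> 0"
    and lam: "\<And>p q. 1 \<le> p \<Longrightarrow> p \<le> q \<Longrightarrow> q \<le> m \<Longrightarrow> lam q \<le> lam p"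
  shows "(\<Sum>p=1..m. lam p * sorted_abs m (b(i := 0)) p) + lam (card {j. j < m \<and> b j \<noteq> 0}) * \<bar>b i\<bar>
     \<le> (\<Sum>p=1..m. lam p * sorted_abs m b p)"
proof -
  obtain js where up: "mset [0..<m] = add_mset i (mset js)" and js: "distinct js" "set js = {..<m} - {i}"
  proof
    show "mset [0..<m] = add_mset i (mset (remove1 i [0..<m]))" using i by simp
  qed auto
  define ds where "ds = sort_key uminus (map (\<lambda>j. \<bar>b j\<bar>) js)"
  have len: "length ds = m - 1" using arg_cong[OF up, of size] by (simp add: ds_def)
  have sd: "sorted_wrt (\<ge>) ds"
    using sorted_sort_key[of uminus "map (\<lambda>j. \<bar>b j\<bar>) js"]
    by (simp add: ds_def sorted_wrt_map)
  \<comment> \<open>A non-increasing list is determined by its multiset, so both sorted lists can be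
    identified by comparing multisets.\<close>
  have eq: "rev (sort xs) = ys" if "mset xs = mset ys" "sorted_wrt (\<ge>) ys" for xs ys :: "real list"
  proof -
    have "sort xs = rev ys" using that by (intro properties_for_sort) (auto simp: sorted_wrt_rev)
    then show ?thesis by simp
  qed
  have 1: "rev (sort (map (\<lambda>j. \<bar>b j\<bar>) [0..<m])) = insort_key uminus \<bar>b i\<bar> ds"
  proof (rule eq)
    show "mset (map (\<lambda>j. \<bar>b j\<bar>) [0..<m]) = mset (insort_key uminus \<bar>b i\<bar> ds)"
      by (simp add: ds_def up del: mset_upt)
    have "sorted (map uminus (insort_key uminus \<bar>b i\<bar> ds))"
      using sd by (subst sorted_insort_key) (simp add: sorted_wrt_map)
    then show "sorted_wrt (\<ge>) (insort_key uminus \<bar>b i\<bar> ds)" by (simp add: sorted_wrt_map)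
  qed
  have 2: "rev (sort (map (\<lambda>j. \<bar>(b(i:=0)) j\<bar>) [0..<m])) = ds @ [0]"
  proof (rule eq)
    have "mset (map (\<lambda>j. \<bar>(b(i:=0)) j\<bar>) js) = mset (map (\<lambda>j. \<bar>b j\<bar>) js)"
      by (rule arg_cong[of _ _ mset]) (use js in \<open>auto intro!: map_cong\<close>)
    then show "mset (map (\<lambda>j. \<bar>(b(i:=0)) j\<bar>) [0..<m]) = mset (ds @ [0])"
      by (simp add: ds_def up del: mset_upt)
    show "sorted_wrt (\<ge>) (ds @ [0])" using sd by (auto simp: sorted_wrt_append ds_def)
  qed
  \<comment> \<open>Ranks run from 1 to \<open>m\<close> but list positions start at 0, hence the
    weights \<open>lam (Suc p)\<close> from here on.\<close>
  have shift: "(\<Sum>p=1..m. lam p * g (p - 1)) = (\<Sum>p<m. lam (Suc p) * g p)" for g :: "nat \<Rightarrow> real"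
    using sum.shift_bounds_Suc_ivl[of "\<lambda>p. lam p * g (p - 1)" 0 m]
    by (simp add: atLeastLessThanSuc_atLeastAtMost lessThan_atLeast0)
  have m: "m = Suc (length ds)" using len i by simp
  have c1: "length (filter (\<lambda>y. y \<noteq> 0) ds) = card {j. j < m \<and> j \<noteq> i \<and> b j \<noteq> 0}"
  proof -
    have "length (filter (\<lambda>y. y \<noteq> 0) ds) = size (filter_mset (\<lambda>y. y \<noteq> 0) (mset ds))"
      by (metis mset_filter size_mset)
    also have "\<dots> = size (filter_mset (\<lambda>y. y \<noteq> 0) (mset (map (\<lambda>j. \<bar>b j\<bar>) js)))"
      by (simp add: ds_def)
    also have "\<dots> = length (filter (\<lambda>y. y \<noteq> 0) (map (\<lambda>j. \<bar>b j\<bar>) js))"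
      by (metis mset_filter size_mset)
    also have "\<dots> = length (filter (\<lambda>j. b j \<noteq> 0) js)" 
      by (simp add: filter_map o_def)
    also have "\<dots> = card (set (filter (\<lambda>j. b j \<noteq> 0) js))"
      using js by (intro distinct_card[symmetric]) simp
    also have "set (filter (\<lambda>j. b j \<noteq> 0) js) = {j. j < m \<and> j \<noteq> i \<and> b j \<noteq> 0}"
      using js by auto
    finally show ?thesis .
  qed
  \<comment> \<open>Coordinate \<open>i\<close> itself is nonzero and adds one to the count in
    \<open>ds\<close>; this is the same \<open>Suc\<close> as in the shifted weights.\<close>
  have "{j. j < m \<and> b j \<noteq> 0} = insert i {j. j < m \<and> j \<noteq> i \<and> b j \<noteq> 0}" using i by auto
  then have c2: "card {j. j < m \<and> b j \<noteq> 0} = Suc (length (filter (\<lambda>y. y \<noteq> 0) ds))"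
    unfolding c1 by simp
  have "(\<Sum>p<length ds. lam (Suc p) * ds ! p) + lam (Suc (length (filter (\<lambda>y. y \<noteq> 0) ds))) * \<bar>b i\<bar>
     \<le> (\<Sum>p<Suc (length ds). lam (Suc p) * insort_key uminus \<bar>b i\<bar> ds ! p)"
    using m by (intro weighted_sum_insort[where l="\<lambda>p. lam (Suc p)"] sd allI impI lam)
      (auto simp: ds_def)
  moreover have "(\<Sum>p<length ds. lam (Suc p) * ds ! p) = (\<Sum>p<m. lam (Suc p) * (ds @ [0]) ! p)"
    unfolding m by (simp add: nth_append)
  ultimately show ?thesis
    unfolding sorted_abs_def 1 2 shift c2 using m by simp
qed

text \<open>Write \<open>z\<close> for the inner product of column \<open>i\<close> with
  \<open>y\<close>. Zeroing \<open>b i\<close> raises half the squared residual by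
  \<open>b i * z - (b i)^2 / 2\<close> and lowers the penalty by at least
  \<open>\<sigma> * L * \<bar>b i\<bar>\<close>, with \<open>L\<close> the weight at the number of
  selected features. Minimality makes the second at most the first, and dividing by
  \<open>\<bar>b i\<bar>\<close> gives the bound.\<close>

lemma slope_selected_ge:
  assumes orth: "\<And>j l. j < m \<Longrightarrow> l < m \<Longrightarrow> (\<Sum>i<n. X i j * X i l) = (if j = l then 1 else 0)"
    and "\<sigma> > 0"
    and lam: "\<And>p q. 1 \<le> p \<Longrightarrow> p \<le> q \<Longrightarrow> q \<le> m \<Longrightarrow> lam q \<le> lam p"
    and i: "i < m" "b i \<noteq> 0"
    and argmin: "\<And>b'. slope_obj n m X \<sigma> lam y b \<le> slope_obj n m X \<sigma> lam y b'"
  shows "\<sigma> * lam (card {j. j < m \<and> b j \<noteq> 0}) \<le> \<bar>\<Sum>l<n. X l i * y l\<bar>"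
proof -
  define z where "z = (\<Sum>l<n. X l i * y l)"
  define r where "r = (\<lambda>l. y l - (\<Sum>j<m. X l j * b j))"
  define L where "L = lam (card {j. j < m \<and> b j \<noteq> 0})"
  have res: "y l - (\<Sum>j<m. X l j * (b(i:=0)) j) = r l + X l i * b i" for l
  proof -
    have "(\<Sum>j<m. X l j * b j) = X l i * b i + (\<Sum>j\<in>{..<m}-{i}. X l j * b j)"
      using i by (subst sum.remove[of _ i]) auto
    moreover have "(\<Sum>j<m. X l j * (b(i:=0)) j) = (\<Sum>j\<in>{..<m}-{i}. X l j * b j)"
      using i by (subst sum.remove[of _ i]) auto
    ultimately show ?thesis by (simp add: r_def)
  qed
  \<comment> \<open>Orthonormality removes every coordinate of \<open>b\<close> but the one at
    \<open>i\<close> from the inner product of column \<open>i\<close> with the residual.\<close>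
  have Xr: "(\<Sum>l<n. X l i * r l) = z - b i"
  proof -
    have "(\<Sum>l<n. X l i * (\<Sum>j<m. X l j * b j)) = (\<Sum>j<m. (\<Sum>l<n. X l i * X l j) * b j)"
      by (simp add: sum_distrib_left sum_distrib_right sum.swap[of _ "{..<n}"] mult.assoc)
    also have "\<dots> = (\<Sum>j<m. if i = j then b j else 0)"
      using i by (intro sum.cong) (auto simp: orth)
    also have "\<dots> = b i" using i by simp
    finally show ?thesis by (simp add: r_def z_def right_diff_distrib sum_subtractf)
  qed
  have "(\<Sum>l<n. (r l + X l i * b i)\<^sup>2)
     = (\<Sum>l<n. (r l)\<^sup>2) + 2 * b i * (\<Sum>l<n. X l i * r l) + (b i)\<^sup>2 * (\<Sum>l<n. X l i * X l i)"
    by (simp add: power2_sum sum.distrib sum_distrib_left power2_eq_square algebra_simps)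
  also have "\<dots> = (\<Sum>l<n. (r l)\<^sup>2) + 2 * b i * (z - b i) + (b i)\<^sup>2"
    using i by (simp add: Xr orth)
  finally have sq: "(\<Sum>l<n. (r l + X l i * b i)\<^sup>2) = (\<Sum>l<n. (r l)\<^sup>2) + 2 * b i * (z - b i) + (b i)\<^sup>2" .
  have "\<sigma> * ((\<Sum>p=1..m. lam p * sorted_abs m (b(i := 0)) p) + L * \<bar>b i\<bar>)
     \<le> \<sigma> * (\<Sum>p=1..m. lam p * sorted_abs m b p)"
    unfolding L_def using i lam \<open>\<sigma> > 0\<close> by (intro mult_left_mono sorted_abs_sum_zero_coordinate) auto
  moreover have "1/2 * (\<Sum>l<n. (r l)\<^sup>2) + \<sigma> * (\<Sum>p=1..m. lam p * sorted_abs m b p)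
     \<le> 1/2 * (\<Sum>l<n. (r l + X l i * b i)\<^sup>2) + \<sigma> * (\<Sum>p=1..m. lam p * sorted_abs m (b(i := 0)) p)"
    using argmin[of "b(i := 0)"] by (simp only: slope_obj_def res) (simp only: r_def)
  ultimately have "\<sigma> * L * \<bar>b i\<bar> \<le> b i * (z - b i) + (b i)\<^sup>2 / 2"
    unfolding sq by (simp add: algebra_simps power2_eq_square)
  also have "\<dots> \<le> b i * z" by (simp add: algebra_simps power2_eq_square)
  also have "\<dots> \<le> \<bar>z\<bar> * \<bar>b i\<bar>" by (metis abs_ge_self abs_mult mult.commute)
  finally show ?thesis using i by (simp add: L_def z_def)
qed

subsection \<open>The k-FWER bound\<close>

text \<open>\<open>m + k - p\<close> is at least \<open>m\<close> exactly for \<open>p\<close> up to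
  \<open>k\<close>, so the minimum merges the two branches.\<close>

lemma lambda_kfwer_eq:
  "p \<le> m \<Longrightarrow> lambda_kfwer m k \<alpha> p = Phi_inv (1 - real k * \<alpha> / (2 * real (min m (m + k - p))))"
  by (auto simp: lambda_kfwer_def min_def)

text \<open>The denominator \<open>min m (m + k - p)\<close> is at least \<open>k\<close>, so the
  subtracted term is at most \<open>\<alpha> / 2\<close>. This keeps the argument of
  \<open>Phi_inv\<close> strictly between 0 and 1, where \<open>Phi_inv\<close> inverts
  \<open>Phi\<close>.\<close>

lemma kfwer_level_bounds:
  assumes "1 \<le> k" "k \<le> m" "0 < \<alpha>" "\<alpha> < 1" "p \<le> m"
  shows "0 < 1 - real k * \<alpha> / (2 * real (min m (m + k - p)))"
    and "1 - real k * \<alpha> / (2 * real (min m (m + k - p))) < 1"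
proof -
  define d where "d = real (min m (m + k - p))"
  have "k \<le> min m (m + k - p)" using assms by linarith
  then have "real k \<le> d" unfolding d_def by (rule of_nat_mono)
  moreover have "real k * \<alpha> < real k" using assms by simp
  ultimately have "0 < d" "real k * \<alpha> < 2 * d" using assms by linarith+
  then have "0 < 1 - real k * \<alpha> / (2 * d)" "1 - real k * \<alpha> / (2 * d) < 1"
    using assms by (auto simp: field_simps)
  then show "0 < 1 - real k * \<alpha> / (2 * real (min m (m + k - p)))"
    "1 - real k * \<alpha> / (2 * real (min m (m + k - p))) < 1" by (simp_all add: d_def)
qed

lemma lambda_kfwer_antimono:
  assumes "1 \<le> k" "k \<le> m" "0 < \<alpha>" "\<alpha> < 1" "p \<le> q" "q \<le> m"
  shows "lambda_kfwer m k \<alpha> q \<le> lambda_kfwer m k \<alpha> p"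
proof -
  have "real k * \<alpha> / (2 * real (min m (m + k - p))) \<le> real k * \<alpha> / (2 * real (min m (m + k - q)))"
    using assms by (intro divide_left_mono) (auto simp: min_def)
  then show ?thesis
    using assms kfwer_level_bounds[of k m \<alpha>] by (simp add: lambda_kfwer_eq Phi_inv_mono)
qed

text \<open>Read \<open>v\<close> as the number of selected nulls among \<open>m\<^sub>0\<close> and
  \<open>r\<close> as the number of all selections. The bound on \<open>r\<close> makes the
  denominator at least \<open>m\<^sub>0 + k - v\<close>. The remaining comparison is an equality at
  \<open>v = k\<close> and at \<open>v = m\<^sub>0\<close>.\<close>

lemma kfwer_level_le_simes_level:
  fixes \<alpha> :: real and k v m\<^sub>0 m r :: nat
  assumes "1 \<le> k" "k \<le> v" "v \<le> m\<^sub>0" "m\<^sub>0 \<le> m" "r \<le> v + (m - m\<^sub>0)" "v \<le> r" "0 \<le> \<alpha>"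
  shows "real k * \<alpha> / real (min m (m + k - r)) \<le> real v * \<alpha> / real m\<^sub>0"
proof -
  have "m\<^sub>0 + k - v \<le> min m (m + k - r)" using assms by simp
  then have "real k * \<alpha> / real (min m (m + k - r)) \<le> real k * \<alpha> / real (m\<^sub>0 + k - v)"
    using assms by (intro divide_left_mono) auto
  also have "real k / real (m\<^sub>0 + k - v) \<le> real v / real m\<^sub>0"
  proof -
    \<comment> \<open>Expanded, this product is
      \<open>v * (m\<^sub>0 + k - v) - k * m\<^sub>0\<close>.\<close>
    have "0 \<le> (real v - real k) * (real m\<^sub>0 - real v)" using assms by simp
    then have "real k * real m\<^sub>0 \<le> real v * real (m\<^sub>0 + k - v)"
      using assms by (simp add: of_nat_diff algebra_simps)
    then show ?thesis using assms by (simp add: divide_simps)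
  qed
  then have "real k * \<alpha> / real (m\<^sub>0 + k - v) \<le> real v * \<alpha> / real m\<^sub>0"
    using \<open>0 \<le> \<alpha>\<close> by (metis mult_right_mono times_divide_eq_left)
  finally show ?thesis .
qed

lemma prob_two_sided_p_value_le:
  assumes "prob_space M" and W[measurable]: "W \<in> borel_measurable M"
    and "distr M borel W = gaussian \<sigma>" "0 < \<sigma>" "0 \<le> u" "u \<le> 1"
  shows "measure M {\<omega>\<in>space M. 2 * (1 - Phi (\<bar>W \<omega>\<bar> / \<sigma>)) \<le> u} \<le> u"
proof -
  have "measure M {\<omega>\<in>space M. 2 * (1 - Phi (\<bar>W \<omega>\<bar> / \<sigma>)) \<le> u}
      = measure (distr M borel W) {x. 2 * (1 - Phi (\<bar>x\<bar> / \<sigma>)) \<le> u}"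
    by (subst measure_distr) (auto intro!: arg_cong[where f="measure M"])
  also have "\<dots> = measure std_normal_distribution {x. 2 * (1 - Phi \<bar>x\<bar>) \<le> u}"
    unfolding assms(3) gaussian_scaled_std[OF \<open>0 < \<sigma>\<close>] using \<open>0 < \<sigma>\<close>
    by (subst measure_distr) (auto simp: abs_mult)
  also have "\<dots> \<le> u" using assms by (intro two_sided_p_value_superuniform)
  finally show ?thesis .
qed

theorem theorem4:
  fixes n m k :: nat and X :: "nat \<Rightarrow> nat \<Rightarrow> real" and \<beta> :: "nat \<Rightarrow> real"
    and \<sigma> \<alpha> :: real and bhat :: "(nat \<Rightarrow> real) \<Rightarrow> (nat \<Rightarrow> real)"
  assumes "m \<le> n"
    and orth: "\<forall>j<m. \<forall>l<m. (\<Sum>i<n. X i j * X i l) = (if j = l then 1 else 0)"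
    and "\<sigma> > 0"
    and "1 \<le> k" "k \<le> m"
    and "0 < \<alpha>" "\<alpha> < 1"
    and argmin: "\<forall>y b. slope_obj n m X \<sigma> (lambda_kfwer m k \<alpha>) y (bhat y)
                        \<le> slope_obj n m X \<sigma> (lambda_kfwer m k \<alpha>) y b"
  shows "measure (noise_dist n \<sigma>)
           {\<epsilon> \<in> space (noise_dist n \<sigma>).
              k \<le> card {i. i < m \<and> \<beta> i = 0 \<and>
                 bhat (\<lambda>l. (\<Sum>j<m. X l j * \<beta> j) + \<epsilon> l) i \<noteq> 0}} \<le> \<alpha>"
proof -
  define I where "I = {i. i < m \<and> \<beta> i = 0}"
  define W where "W i \<epsilon> = (\<Sum>l<n. X l i * \<epsilon> l)" for i and \<epsilon> :: "nat \<Rightarrow> real"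
  define p where "p i \<epsilon> = 2 * (1 - Phi (\<bar>W i \<epsilon>\<bar> / \<sigma>))" for i \<epsilon>
  have fin: "finite I" and Im: "card I \<le> m"
    using card_mono[of "{..<m}" I] by (auto simp: I_def)
  have orthI: "(\<Sum>i<n. X i j * X i l) = (if j = l then 1 else 0)" if "j \<in> I" "l \<in> I" for j l
    using orth that by (simp add: I_def)
  interpret prob_space "noise_dist n \<sigma>" using \<open>0 < \<sigma>\<close> by (rule prob_space_noise)
  have W[measurable]: "random_variable borel (W i)" for i
    unfolding W_def by (rule measurable_column_noise)
  have "indep_vars (\<lambda>_. borel) W I"
  proof (rule indep_vars_if_char_prod[OF fin W])
    show "(CLINT \<epsilon>|noise_dist n \<sigma>. \<Prod>i\<in>I. iexp (s i * W i \<epsilon>)) = (\<Prod>i\<in>I. CLINT \<epsilon>|noise_dist n \<sigma>. iexp (s i * W i \<epsilon>))" for s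
    proof -
      have "(CLINT \<epsilon>|noise_dist n \<sigma>. \<Prod>i\<in>I. iexp (s i * W i \<epsilon>)) = (\<Prod>i\<in>I. exp (- (\<sigma> * s i)\<^sup>2 / 2))"
        unfolding W_def using fin \<open>0 < \<sigma>\<close> orthI by (rule integral_iexp_columns_noise)
      moreover have "(CLINT \<epsilon>|noise_dist n \<sigma>. iexp (s i * W i \<epsilon>)) = exp (- (\<sigma> * s i)\<^sup>2 / 2)" if "i \<in> I" for i
        unfolding W_def using fin \<open>0 < \<sigma>\<close> orthI that by (rule integral_iexp_column_noise)
      ultimately show ?thesis by (simp only: of_real_prod cong: prod.cong)
    qed
  qed
  then have "indep_vars (\<lambda>_. borel) p I"
    unfolding p_def by (rule indep_vars_compose2) measurable
  then have simes: "prob {\<epsilon>\<in>space (noise_dist n \<sigma>). \<exists>v\<ge>1. v \<le> card {j\<in>I. p j \<epsilon> \<le> real v * \<alpha> / real (card I)}} \<le> \<alpha>"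
  proof (rule simes_inequality[OF fin])
    show "prob {\<epsilon>\<in>space (noise_dist n \<sigma>). p j \<epsilon> \<le> u} \<le> u" if "j \<in> I" "0 \<le> u" "u \<le> 1" for j u
    proof -
      have "distr (noise_dist n \<sigma>) borel (W j) = gaussian \<sigma>"
        unfolding W_def[abs_def] using fin \<open>0 < \<sigma>\<close> orthI \<open>j \<in> I\<close> by (rule distr_column_noise)
      then show ?thesis
        unfolding p_def using \<open>0 < \<sigma>\<close> that(2,3)
        by (rule prob_two_sided_p_value_le[OF prob_space_axioms W])
    qed
  qed (use \<open>0 < \<alpha>\<close> \<open>\<alpha> < 1\<close> in auto)
  \<comment> \<open>This is the passage from SLOPE to Simes: each falsely selected feature has a
    p-value below the Simes threshold whose index \<open>v\<close> is the number of false selections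
    itself.\<close>
  have p_le: "p i \<epsilon> \<le> real v * \<alpha> / real (card I)"
    if b: "b = bhat (\<lambda>l. (\<Sum>j<m. X l j * \<beta> j) + \<epsilon> l)" and v: "v = card {i\<in>I. b i \<noteq> 0}" "k \<le> v"
      and i: "i \<in> I" "b i \<noteq> 0" for i \<epsilon> b v
  proof -
    define r where "r = card {j. j < m \<and> b j \<noteq> 0}"
    define d where "d = real (min m (m + k - r))"
    \<comment> \<open>Every selected feature is a selected null or one of the
      \<open>m - card I\<close> non-nulls.\<close>
    have "r \<le> card ({i\<in>I. b i \<noteq> 0} \<union> ({..<m} - I))"
      unfolding r_def by (rule card_mono) (auto simp: I_def)
    also have "\<dots> \<le> v + card ({..<m} - I)" unfolding v by (rule card_Un_le)
    also have "card ({..<m} - I) = m - card I" using fin by (subst card_Diff_subset) (auto simp: I_def)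
    finally have r: "r \<le> v + (m - card I)" .
    have "v \<le> r" unfolding r_def v by (rule card_mono) (auto simp: I_def)
    have "v \<le> card I" unfolding v using fin by (intro card_mono) auto
    have "r \<le> m" unfolding r_def using card_mono[of "{..<m}" "{j. j < m \<and> b j \<noteq> 0}"] by auto
    \<comment> \<open>Column \<open>i\<close> picks the entry \<open>i\<close> out of the signal,
      and this is 0 for a null feature, so only the noise remains.\<close>
    have z: "(\<Sum>l<n. X l i * ((\<Sum>j<m. X l j * \<beta> j) + \<epsilon> l)) = W i \<epsilon>"
    proof -
      have "(\<Sum>l<n. X l i * (\<Sum>j<m. X l j * \<beta> j)) = (\<Sum>j<m. (\<Sum>l<n. X l i * X l j) * \<beta> j)"
        by (simp add: sum_distrib_left sum_distrib_right sum.swap[of _ "{..<n}"] mult.assoc)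
      also have "\<dots> = (\<Sum>j<m. if i = j then \<beta> j else 0)"
        using i orth by (intro sum.cong) (auto simp: I_def)
      also have "\<dots> = 0" using i by (simp add: I_def)
      finally show ?thesis by (simp add: W_def distrib_left sum.distrib)
    qed
    have "\<sigma> * lambda_kfwer m k \<alpha> r \<le> \<bar>W i \<epsilon>\<bar>"
      unfolding r_def z[symmetric]
      using orth \<open>0 < \<sigma>\<close> assms(4-7) i argmin b
      by (intro slope_selected_ge lambda_kfwer_antimono) (auto simp: I_def)
    then have "Phi_inv (1 - real k * \<alpha> / (2 * d)) \<le> \<bar>W i \<epsilon>\<bar> / \<sigma>"
      using \<open>0 < \<sigma>\<close> \<open>r \<le> m\<close> by (simp add: lambda_kfwer_eq d_def field_simps)
    then have "Phi (Phi_inv (1 - real k * \<alpha> / (2 * d))) \<le> Phi (\<bar>W i \<epsilon>\<bar> / \<sigma>)"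
      by (simp add: strict_mono_less_eq[OF Phi_strict_mono])
    then have "1 - real k * \<alpha> / (2 * d) \<le> Phi (\<bar>W i \<epsilon>\<bar> / \<sigma>)"
      unfolding d_def by (simp only: Phi_Phi_inv kfwer_level_bounds[OF assms(4-7) \<open>r \<le> m\<close>])
    then have "p i \<epsilon> \<le> real k * \<alpha> / d" by (simp add: p_def field_simps)
    also have "\<dots> \<le> real v * \<alpha> / real (card I)"
      unfolding d_def using assms(4-7) r \<open>v \<le> r\<close> \<open>v \<le> card I\<close> Im \<open>k \<le> v\<close>
      by (intro kfwer_level_le_simes_level) auto
    finally show ?thesis .
  qed
  have "{\<epsilon> \<in> space (noise_dist n \<sigma>).
              k \<le> card {i. i < m \<and> \<beta> i = 0 \<and>
                 bhat (\<lambda>l. (\<Sum>j<m. X l j * \<beta> j) + \<epsilon> l) i \<noteq> 0}}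
    \<subseteq> {\<epsilon>\<in>space (noise_dist n \<sigma>). \<exists>v\<ge>1. v \<le> card {j\<in>I. p j \<epsilon> \<le> real v * \<alpha> / real (card I)}}" (is "?A \<subseteq> ?B")
  proof
    fix \<epsilon> assume \<epsilon>: "\<epsilon> \<in> ?A"
    define b where "b = bhat (\<lambda>l. (\<Sum>j<m. X l j * \<beta> j) + \<epsilon> l)"
    define v where "v = card {i\<in>I. b i \<noteq> 0}"
    have "k \<le> v" using \<epsilon> by (simp add: v_def b_def I_def)
    \<comment> \<open>All \<open>v\<close> falsely selected features lie below the threshold of
      index \<open>v\<close>, so \<open>v\<close> is the witness for the Simes event.\<close>
    have "v \<le> card {j\<in>I. p j \<epsilon> \<le> real v * \<alpha> / real (card I)}"
      unfolding v_def
      by (rule card_mono) (use fin p_le[OF b_def v_def \<open>k \<le> v\<close>] in \<open>auto simp: v_def\<close>)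
    moreover have "1 \<le> v" using \<open>1 \<le> k\<close> \<open>k \<le> v\<close> by simp
    ultimately show "\<epsilon> \<in> ?B" using \<epsilon> by blast
  qed
  \<comment> \<open>Monotonicity asks for measurability of the larger set \<open>?B\<close>, which
    involves only the p-values; \<open>?A\<close> involves the arbitrary selection
    \<open>bhat\<close> of minimizers.\<close>
  then have "prob ?A \<le> prob ?B"
    by (rule finite_measure_mono) (unfold p_def, measurable)
  also note simes
  finally show ?thesis .
qed

end
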